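(* Let $\mathrm{a}\ge0$, $\alpha\in(0,1)$, and let $\mathfrak{w}:[\mathrm{a},\infty)\to\mathcal{F}$ be a fuzzy function that is $\alpha_{gH}$-differentiable (with base point $\mathrm{a}$) at a point $\tau>\mathrm{a}$. Then $${}_{gH}\mathbf{T}^{\mathrm{a}}_{\alpha}(\mathfrak{w}(\tau))=(\tau-\mathrm{a})^{1-\alpha}\,\mathfrak{w}'_{gH}(\tau).$$
   Context: A fuzzy number is a map $\mathcal{P}:\mathbb{R}\to[0,1]$ that is normal, fuzzy convex, upper semicontinuous and compactly supported; $\mathcal{F}$ is the set of fuzzy numbers and $\Omega\subset\mathcal{F}$ the set of triangular fuzzy numbers. For $r\in(0,1]$, $[\mathcal{P}]^r=\{x:\mathcal{P}(x)\ge r\}$, and $[\mathcal{P}]^0=\overline{\{x:\mathcal{P}(x)>0\}}$; each $[\mathcal{P}]^r=[\mathcal{P}_1(r),\mathcal{P}_2(r)]$ is a compact interval. Addition $\oplus$ and multiplication by real scalars are levelwise: $[\mathcal{P}\oplus\mathcal{Q}]^r=[\mathcal{P}]^r+[\mathcal{Q}]^r$, $[c\,\mathcal{P}]^r=c[\mathcal{P}]^r$. The generalized Hukuhara difference $\mathcal{P}\ominus_{gH}\mathcal{Q}$ is the fuzzy number $\mathcal{R}$ (if it exists) such that $\mathcal{P}=\mathcal{Q}\oplus\mathcal{R}$ or $\mathcal{Q}=\mathcal{P}\oplus(-1)\mathcal{R}$. Standing assumption: the gH-differences that occur exist and belong to $\Omega$. Limits are taken in the Hausdorff metric $D(\mathcal{P},\mathcal{Q})=\sup_{r\in[0,1]}\max\{|\mathcal{P}_1(r)-\mathcal{Q}_1(r)|,|\mathcal{P}_2(r)-\mathcal{Q}_2(r)|\}$.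 The generalized Hukuhara conformable fractional derivative of order $\alpha$ with base point $\mathrm{a}$ is $${}_{gH}\mathbf{T}^{\mathrm{a}}_{\alpha}(\mathfrak{w}(\tau))=\lim_{\epsilon\to0}\frac{\mathfrak{w}(\tau+\epsilon(\tau-\mathrm{a})^{1-\alpha})\ominus_{gH}\mathfrak{w}(\tau)}{\epsilon};$$ $\mathfrak{w}$ is $\alpha_{gH}$-differentiable at $\tau$ if this limit exists in $\mathcal{F}$. The gH-derivative is $\mathfrak{w}'_{gH}(\tau)=\lim_{h\to0}\frac{\mathfrak{w}(\tau+h)\ominus_{gH}\mathfrak{w}(\tau)}{h}$, provided the limit exists in $\mathcal{F}$. *)

theory Defs
  imports "HOL-Analysis.Analysis"
begin

section \<open>Fuzzy numbers and their level sets\<close>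

definition is_fuzzy_number :: "(real \<Rightarrow> real) \<Rightarrow> bool" where
  "is_fuzzy_number P \<longleftrightarrow>
     (\<forall>x. P x \<in> {0..1}) \<and>
     (\<exists>x. P x = 1) \<and>
     (\<forall>x y. \<forall>t\<in>{0..1}. P ((1 - t) * x + t * y) \<ge> min (P x) (P y)) \<and>
     (\<forall>x. \<forall>e>0. \<forall>\<^sub>F y in nhds x. P y < P x + e) \<and>
     compact (closure {x. P x > 0})"

definition level_of :: "(real \<Rightarrow> real) \<Rightarrow> real \<Rightarrow> real set" where
  "level_of P r = (if r = 0 then closure {x. P x > 0} else {x. P x \<ge> r})"

text \<open>The membership function whose level sets are the members of a given family
  (for the families used below, see \<open>of_levels\<close>).\<close>

definition of_levels :: "(real \<Rightarrow> real set) \<Rightarrow> real \<Rightarrow> real" where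
  "of_levels L x = Sup (insert 0 {r \<in> {0..1}. x \<in> L r})"

text \<open>The conditions characterizing the level intervals \<open>[l r, u r]\<close> of a fuzzy number
  (Goetschel--Voxman); used only to show that the levelwise operations are well defined.\<close>

definition endpoints :: "(real \<Rightarrow> real) \<Rightarrow> (real \<Rightarrow> real) \<Rightarrow> bool" where
  "endpoints l u \<longleftrightarrow>
     (\<forall>r\<in>{0..1}. l r \<le> u r) \<and>
     (\<forall>r s. 0 \<le> r \<and> r \<le> s \<and> s \<le> 1 \<longrightarrow> l r \<le> l s \<and> u s \<le> u r) \<and>
     (\<forall>r e. 0 < r \<and> r \<le> 1 \<and> 0 < e \<longrightarrow> (\<exists>s. 0 < s \<and> s < r \<and> l r - e < l s \<and> u s < u r + e)) \<and>
     (\<forall>e>0. \<exists>r. 0 < r \<and> r \<le> 1 \<and> l r < l 0 + e \<and> u 0 - e < u r)"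

lemma of_levels:
  assumes E: "endpoints l u" and L: "\<And>r. 0 \<le> r \<Longrightarrow> r \<le> 1 \<Longrightarrow> L r = {l r..u r}"
  shows "is_fuzzy_number (of_levels L)"
    and "\<And>r. 0 \<le> r \<Longrightarrow> r \<le> 1 \<Longrightarrow> level_of (of_levels L) r = L r"
proof -
  let ?P = "of_levels L"
  let ?S = "\<lambda>x. insert 0 {r \<in> {0..1}. x \<in> L r}"
  have le: "\<And>r. 0 \<le> r \<Longrightarrow> r \<le> 1 \<Longrightarrow> l r \<le> u r"
    and mono: "\<And>r s. 0 \<le> r \<Longrightarrow> r \<le> s \<Longrightarrow> s \<le> 1 \<Longrightarrow> l r \<le> l s \<and> u s \<le> u r"
    and lc: "\<And>r e. 0 < r \<Longrightarrow> r \<le> 1 \<Longrightarrow> 0 < e \<Longrightarrow> \<exists>s. 0 < s \<and> s < r \<and> l r - e < l s \<and> u s < u r + e"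
    and rc: "\<And>e. 0 < e \<Longrightarrow> \<exists>r. 0 < r \<and> r \<le> 1 \<and> l r < l 0 + e \<and> u 0 - e < u r"
    using E unfolding endpoints_def by auto
  have bdd: "bdd_above (?S x)" for x by (rule bdd_aboveI[of _ 1]) auto
  have up: "r \<le> ?P x" if "r \<in> ?S x" for r x
    unfolding of_levels_def using bdd that by (rule cSup_upper[rotated])
  have P0: "0 \<le> ?P x" for x by (rule up) simp
  have P1: "?P x \<le> 1" for x unfolding of_levels_def by (rule cSup_least) auto
  have key: "r \<le> ?P x \<longleftrightarrow> x \<in> L r" if r: "0 < r" "r \<le> 1" for r x
  proof
    assume "x \<in> L r" then show "r \<le> ?P x" using r by (intro up) auto
  next
    assume a: "r \<le> ?P x"
    have in_s: "l s \<le> x \<and> x \<le> u s" if s: "0 < s" "s < r" for s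
    proof -
      have "s < ?P x" using a s by simp
      then obtain t where "t \<in> ?S x" "s < t"
        unfolding of_levels_def using less_cSup_iff[OF _ bdd] by blast
      with s L[of t] mono[of s t] show ?thesis by auto
    qed
    have "l r \<le> x + e" "x \<le> u r + e" if "0 < e" for e
      using lc[OF r that] in_s by (force, force)
    then have "l r \<le> x" "x \<le> u r" by (blast intro: field_le_epsilon)+
    then show "x \<in> L r" using L r by simp
  qed
  have cl: "closure {x. ?P x > 0} = {l 0..u 0}"
  proof
    have "{x. ?P x > 0} \<subseteq> {l 0..u 0}"
    proof
      fix x assume "x \<in> {x. ?P x > 0}"
      then have "0 < ?P x" by simp
      with key[of "?P x" x] P1[of x] L[of "?P x"] mono[of 0 "?P x"] show "x \<in> {l 0..u 0}" by auto
    qed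
    then show "closure {x. ?P x > 0} \<subseteq> {l 0..u 0}" by (rule closure_minimal) simp
    show "{l 0..u 0} \<subseteq> closure {x. ?P x > 0}"
    proof
      fix x assume x: "x \<in> {l 0..u 0}"
      show "x \<in> closure {x. ?P x > 0}" unfolding closure_approachable
      proof (intro allI impI)
        fix e :: real assume "0 < e"
        then obtain r where r: "0 < r" "r \<le> 1" "l r < l 0 + e" "u 0 - e < u r" using rc by blast
        define y where "y = max (l r) (min x (u r))"
        have "y \<in> L r" using L[of r] le[of r] r by (auto simp: y_def)
        then have "0 < ?P y" using key[of r y] r by simp
        moreover have "dist y x < e" using x r le[of r] \<open>0 < e\<close> by (auto simp: y_def dist_real_def)
        ultimately show "\<exists>y\<in>{x. ?P x > 0}. dist y x < e" by blast
      qed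
    qed
  qed
  show lev: "level_of ?P r = L r" if "0 \<le> r" "r \<le> 1" for r
    using that key[of r] cl L[of 0] by (auto simp: level_of_def)
  show "is_fuzzy_number ?P" unfolding is_fuzzy_number_def
  proof (intro conjI allI ballI impI)
    show "?P x \<in> {0..1}" for x using P0 P1 by simp
    have "1 \<le> ?P (l 1)" using key[of 1 "l 1"] L[of 1] le[of 1] by simp
    then show "\<exists>x. ?P x = 1" using P1[of "l 1"] by (intro exI[of _ "l 1"]) simp
    show "min (?P x) (?P y) \<le> ?P ((1 - t) * x + t * y)" if t: "t \<in> {0..1}" for x y t
    proof (cases "min (?P x) (?P y) > 0")
      case True
      define r where "r = min (?P x) (?P y)"
      have r: "0 < r" "r \<le> 1" using True P1[of x] by (auto simp: r_def)
      have "r \<le> ?P x" "r \<le> ?P y" by (simp_all add: r_def)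
      then have "x \<in> L r" "y \<in> L r" using key[OF r] by blast+
      moreover have "convex (L r)" using L[of r] r by simp
      ultimately have "(1 - t) *\<^sub>R x + t *\<^sub>R y \<in> L r" using t by (intro convexD_alt) auto
      then have "r \<le> ?P ((1 - t) * x + t * y)" using key[OF r] by simp
      then show ?thesis by (simp add: r_def)
    next
      case False
      then show ?thesis using P0[of "(1 - t) * x + t * y"] by linarith
    qed
    show "\<forall>\<^sub>F y in nhds x. ?P y < ?P x + e" if "0 < e" for x e
    proof (cases "?P x + e \<le> 1")
      case True
      let ?r = "?P x + e"
      have r: "0 < ?r" using P0[of x] that by simp
      have "x \<in> - L ?r" using key[OF r True, of x] that by simp
      moreover have "open (- L ?r)" using L[of ?r] r True by (simp add: open_Compl)
      ultimately have "\<forall>\<^sub>F y in nhds x. y \<in> - L ?r" by (rule eventually_nhds_in_open[rotated])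
      then show ?thesis by eventually_elim (use key[OF r True] in \<open>auto simp: not_le[symmetric]\<close>)
    next
      case False
      then show ?thesis using P1 by (intro always_eventually) (smt (verit))
    qed
    show "compact (closure {x. ?P x > 0})" using cl by simp
  qed
qed

lemma level_of_interval:
  assumes "is_fuzzy_number P"
  defines "l \<equiv> \<lambda>r. Inf (level_of P r)" and "u \<equiv> \<lambda>r. Sup (level_of P r)"
  shows "\<And>r. 0 \<le> r \<Longrightarrow> r \<le> 1 \<Longrightarrow> level_of P r = {l r..u r}"
    and "endpoints l u"
proof -
  have bounds: "\<And>x. 0 \<le> P x \<and> P x \<le> 1" and normal: "\<exists>x. P x = 1"
    and conv: "\<And>x y t. 0 \<le> t \<Longrightarrow> t \<le> 1 \<Longrightarrow> P ((1 - t) * x + t * y) \<ge> min (P x) (P y)"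
    and usc: "\<And>x e. e > 0 \<Longrightarrow> \<forall>\<^sub>F y in nhds x. P y < P x + e"
    and cpt: "compact (closure {x. P x > 0})"
    using assms(1) unfolding is_fuzzy_number_def by auto
  obtain x1 where x1: "P x1 = 1" using normal by blast
  have c: "closed {x. r \<le> P x}" for r
  proof -
    have "open (- {x. r \<le> P x})"
    proof (subst open_subopen, rule ballI)
      fix x assume "x \<in> - {x. r \<le> P x}"
      then have "\<forall>\<^sub>F y in nhds x. P y < P x + (r - P x)" by (intro usc) auto
      then obtain T where "open T" "x \<in> T" "\<forall>y\<in>T. P y < r"
        unfolding eventually_nhds by auto
      then show "\<exists>T. open T \<and> x \<in> T \<and> T \<subseteq> - {x. r \<le> P x}" by force
    qed
    then show ?thesis by (simp add: closed_def)
  qed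
  have ne: "x1 \<in> level_of P r" if "0 \<le> r" "r \<le> 1" for r
    using that x1 closure_subset[of "{x. P x > 0}"] by (auto simp: level_of_def)
  have sub0: "level_of P r \<subseteq> level_of P 0" if "0 \<le> r" for r
    using that closure_subset[of "{x. P x > 0}"] by (auto simp: level_of_def)
  have cv: "convex (level_of P r)" for r
  proof -
    have "convex {x. P x > 0}" unfolding convex_alt
      using conv by (simp add: min_def) (smt (verit))
    moreover have "convex {x. r \<le> P x}" unfolding convex_alt
      using conv by (simp add: min_def) (smt (verit))
    ultimately show ?thesis by (auto simp: level_of_def convex_closure)
  qed
  have cp: "compact (level_of P r)" if "0 \<le> r" for r
  proof -
    have "closed (level_of P r)" using c by (auto simp: level_of_def)
    then have "compact (level_of P 0 \<inter> level_of P r)"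
      using cpt by (intro compact_Int_closed) (auto simp: level_of_def)
    then show ?thesis using sub0[OF that] by (simp add: Int_absorb1)
  qed
  show iv: "level_of P r = {l r..u r}" if "0 \<le> r" "r \<le> 1" for r
  proof -
    obtain a b where ab: "level_of P r = {a..b}"
      using connected_compact_interval_1[of "level_of P r"] convex_connected[OF cv] cp[OF \<open>0 \<le> r\<close>] by auto
    with ne[OF that] have "a \<le> b" by auto
    then show ?thesis using ab by (simp add: l_def u_def)
  qed
  have le: "l r \<le> u r" if "0 \<le> r" "r \<le> 1" for r using ne[OF that] iv[OF that] by auto
  have lu: "l r \<le> x \<and> x \<le> u r \<longleftrightarrow> r \<le> P x" if "0 < r" "r \<le> 1" for r x
    using iv[of r] that by (auto simp: level_of_def set_eq_iff)
  have mono: "l r \<le> l s \<and> u s \<le> u r" if "0 \<le> r" "r \<le> s" "s \<le> 1" for r s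
  proof -
    have "level_of P s \<subseteq> level_of P r"
      using sub0[of s] that by (cases "r = 0") (auto simp: level_of_def)
    then show ?thesis using iv[of r] iv[of s] le[of r] le[of s] that by auto
  qed
  show "endpoints l u" unfolding endpoints_def
  proof (intro conjI allI ballI impI)
    show "l r \<le> u r" if "r \<in> {0..1}" for r using le that by auto
    show "l r \<le> l s" "u s \<le> u r" if "0 \<le> r \<and> r \<le> s \<and> s \<le> 1" for r s
      using mono that by auto
    show "\<exists>s. 0 < s \<and> s < r \<and> l r - e < l s \<and> u s < u r + e"
      if *: "0 < r \<and> r \<le> 1 \<and> 0 < e" for r e
    proof -
      have r: "0 < r" "r \<le> 1" using * by auto
      have a: "P (l r - e) < r" using lu[OF r, of "l r - e"] * by (simp add: not_le[symmetric])
      have b: "P (u r + e) < r" using lu[OF r, of "u r + e"] * by (simp add: not_le[symmetric])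
      obtain s where s: "max 0 (max (P (l r - e)) (P (u r + e))) < s" "s < r"
        using dense[of "max 0 (max (P (l r - e)) (P (u r + e)))" r] a b r by auto
      have s': "0 < s" "s \<le> 1" using s r by auto
      have "\<not> (l s \<le> l r - e \<and> l r - e \<le> u s)" "\<not> (l s \<le> u r + e \<and> u r + e \<le> u s)"
        using lu[OF s'] s by auto
      moreover have "l s \<le> l r" "u r \<le> u s" "l r \<le> u r" using mono[of s r] le[of r] s s' r by auto
      ultimately show ?thesis using s s' * by (intro exI[of _ s]) auto
    qed
    show "\<exists>r. 0 < r \<and> r \<le> 1 \<and> l r < l 0 + e \<and> u 0 - e < u r" if "0 < e" for e
    proof -
      have z: "l 0 \<in> closure {x. P x > 0}" "u 0 \<in> closure {x. P x > 0}"
        using iv[of 0] le[of 0] by (auto simp: level_of_def)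
      obtain x y where x: "P x > 0" "dist x (l 0) < e" and y: "P y > 0" "dist y (u 0) < e"
        using z \<open>0 < e\<close> unfolding closure_approachable by blast
      define r where "r = min (P x) (P y)"
      have r: "0 < r" "r \<le> 1" using x y bounds[of x] by (auto simp: r_def)
      have "l r \<le> x" "y \<le> u r" using lu[OF r, of x] lu[OF r, of y] by (auto simp: r_def)
      then show ?thesis using x y r by (intro exI[of _ r]) (auto simp: dist_real_def)
    qed
  qed
qed

typedef fuzzy_number = "Collect is_fuzzy_number" morphisms membership Abs_fuzzy_number
proof -
  have "endpoints (\<lambda>_. 0) (\<lambda>_. 0)" unfolding endpoints_def
    by (auto intro: dense exI[of _ 1])
  from of_levels(1)[OF this, of "\<lambda>_. {0..0}"] show ?thesis by auto
qed

setup_lifting type_definition_fuzzy_number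

lift_definition level :: "fuzzy_number \<Rightarrow> real \<Rightarrow> real set" is level_of .

definition lower :: "fuzzy_number \<Rightarrow> real \<Rightarrow> real" where "lower P r = Inf (level P r)"

definition upper :: "fuzzy_number \<Rightarrow> real \<Rightarrow> real" where "upper P r = Sup (level P r)"

lemma level_interval: "0 \<le> r \<Longrightarrow> r \<le> 1 \<Longrightarrow> level P r = {lower P r..upper P r}"
  unfolding lower_def upper_def by transfer (rule level_of_interval(1), simp_all)

lemma endpoints_lower_upper: "endpoints (lower P) (upper P)"
  unfolding lower_def upper_def by transfer (rule level_of_interval(2), simp)

lemma lower_le_upper: "0 \<le> r \<Longrightarrow> r \<le> 1 \<Longrightarrow> lower P r \<le> upper P r"
  using endpoints_lower_upper[of P] by (auto simp: endpoints_def)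

lemma fuzzy_number_eqI:
  assumes "\<And>r. 0 \<le> r \<Longrightarrow> r \<le> 1 \<Longrightarrow> level P r = level Q r"
  shows "P = Q"
proof -
  have b: "0 \<le> membership R x \<and> membership R x \<le> 1" for R x
    using membership[of R] by (auto simp: is_fuzzy_number_def)
  have m: "x \<in> level R r \<longleftrightarrow> r \<le> membership R x" if "0 < r" for R r x
    using that by transfer (auto simp: level_of_def)
  have "membership P x = membership Q x" for x
  proof (rule antisym)
    show "membership P x \<le> membership Q x"
      using m[of "membership P x" x] assms[of "membership P x"] b[of P x] b[of Q x]
      by (cases "membership P x = 0") auto
    show "membership Q x \<le> membership P x"
      using m[of "membership Q x" x] assms[of "membership Q x"] b[of P x] b[of Q x]
      by (cases "membership Q x = 0") auto
  qed
  then show ?thesis by (simp add: membership_inject[symmetric] fun_eq_iff)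
qed


section \<open>Levelwise arithmetic\<close>

lemma endpoints_add:
  assumes "endpoints l u" "endpoints l' u'"
  shows "endpoints (\<lambda>r. l r + l' r) (\<lambda>r. u r + u' r)"
  unfolding endpoints_def
proof (intro conjI allI ballI impI)
  note E = assms[unfolded endpoints_def]
  show "l r + l' r \<le> u r + u' r" if "r \<in> {0..1}" for r using E that by (simp add: add_mono)
  show "l r + l' r \<le> l s + l' s" "u s + u' s \<le> u r + u' r" if "0 \<le> r \<and> r \<le> s \<and> s \<le> 1" for r s
    using E that by (simp_all add: add_mono)
  show "\<exists>s>0. s < r \<and> l r + l' r - e < l s + l' s \<and> u s + u' s < u r + u' r + e"
    if *: "0 < r \<and> r \<le> 1 \<and> 0 < e" for r e
  proof -
    have h: "0 < r \<and> r \<le> 1 \<and> 0 < e / 2" using * by simp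
    obtain s where s: "0 < s" "s < r" "l r - e/2 < l s" "u s < u r + e/2"
      using E(1) h by meson
    obtain t where t: "0 < t" "t < r" "l' r - e/2 < l' t" "u' t < u' r + e/2"
      using E(2) h by meson
    have "l s \<le> l (max s t) \<and> u (max s t) \<le> u s" using E(1) s t * by simp
    moreover have "l' t \<le> l' (max s t) \<and> u' (max s t) \<le> u' t" using E(2) s t * by simp
    ultimately show ?thesis using s t by (intro exI[of _ "max s t"]) auto
  qed
  show "\<exists>r>0. r \<le> 1 \<and> l r + l' r < l 0 + l' 0 + e \<and> u 0 + u' 0 - e < u r + u' r"
    if "0 < e" for e
  proof -
    have h: "0 < e / 2" using that by simp
    obtain s where s: "0 < s" "s \<le> 1" "l s < l 0 + e/2" "u 0 - e/2 < u s" using E(1) h by meson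
    obtain t where t: "0 < t" "t \<le> 1" "l' t < l' 0 + e/2" "u' 0 - e/2 < u' t" using E(2) h by meson
    have "l (min s t) \<le> l s \<and> u s \<le> u (min s t)" using E(1) s t by simp
    moreover have "l' (min s t) \<le> l' t \<and> u' t \<le> u' (min s t)" using E(2) s t by simp
    ultimately show ?thesis using s t by (intro exI[of _ "min s t"]) auto
  qed
qed

lemma endpoints_uminus: "endpoints l u \<Longrightarrow> endpoints (\<lambda>r. - u r) (\<lambda>r. - l r)"
  unfolding endpoints_def by (auto simp: minus_less_iff less_minus_iff algebra_simps) (meson)+

lemma endpoints_scale:
  assumes "endpoints l u" "0 < (c::real)"
  shows "endpoints (\<lambda>r. c * l r) (\<lambda>r. c * u r)"
  unfolding endpoints_def
proof (intro conjI allI ballI impI)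
  note E = assms(1)[unfolded endpoints_def]
  show "c * l r \<le> c * u r" if "r \<in> {0..1}" for r using E that assms(2) by simp
  show "c * l r \<le> c * l s" "c * u s \<le> c * u r" if "0 \<le> r \<and> r \<le> s \<and> s \<le> 1" for r s
    using E that assms(2) by simp_all
  show "\<exists>s>0. s < r \<and> c * l r - e < c * l s \<and> c * u s < c * u r + e"
    if *: "0 < r \<and> r \<le> 1 \<and> 0 < e" for r e
  proof -
    have "0 < r \<and> r \<le> 1 \<and> 0 < e / c" using * assms(2) by simp
    then obtain s where "0 < s" "s < r" "l r - e/c < l s" "u s < u r + e/c" using E by meson
    then show ?thesis using assms(2) by (intro exI[of _ s]) (auto simp: field_simps)
  qed
  show "\<exists>r>0. r \<le> 1 \<and> c * l r < c * l 0 + e \<and> c * u 0 - e < c * u r" if "0 < e" for e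
  proof -
    have "0 < e / c" using that assms(2) by simp
    then obtain s where "0 < s" "s \<le> 1" "l s < l 0 + e/c" "u 0 - e/c < u s" using E by meson
    then show ?thesis using assms(2) by (intro exI[of _ s]) (auto simp: field_simps)
  qed
qed

lemma interval_sum:
  fixes a b c d :: real
  assumes "a \<le> b" "c \<le> d"
  shows "{x + y |x y. x \<in> {a..b} \<and> y \<in> {c..d}} = {a + c..b + d}"
proof (intro equalityI subsetI)
  fix z assume "z \<in> {a + c..b + d}"
  then have "z = max a (z - d) + (z - max a (z - d)) \<and> max a (z - d) \<in> {a..b}
    \<and> z - max a (z - d) \<in> {c..d}" using assms by auto
  then show "z \<in> {x + y |x y. x \<in> {a..b} \<and> y \<in> {c..d}}" by blast
qed auto

instantiation fuzzy_number :: plus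
begin

lift_definition plus_fuzzy_number :: "fuzzy_number \<Rightarrow> fuzzy_number \<Rightarrow> fuzzy_number"
  is "\<lambda>P Q. of_levels (\<lambda>r. {x + y |x y. x \<in> level_of P r \<and> y \<in> level_of Q r})"
proof (unfold mem_Collect_eq)
  fix P Q assume "is_fuzzy_number P" "is_fuzzy_number Q"
  note P = level_of_interval[OF this(1)] and Q = level_of_interval[OF this(2)]
  have le: "Inf (level_of P r) \<le> Sup (level_of P r)" "Inf (level_of Q r) \<le> Sup (level_of Q r)"
    if "0 \<le> r" "r \<le> 1" for r using P(2) Q(2) that by (auto simp: endpoints_def)
  show "is_fuzzy_number (of_levels (\<lambda>r. {x + y |x y. x \<in> level_of P r \<and> y \<in> level_of Q r}))"
    by (rule of_levels(1)[OF endpoints_add[OF P(2) Q(2)]])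
       (subst P(1), assumption+, subst Q(1), assumption+, rule interval_sum[OF le])
qed

instance ..

end

lemma level_plus:
  assumes "0 \<le> r" "r \<le> 1"
  shows "level (P + Q) r = {x + y |x y. x \<in> level P r \<and> y \<in> level Q r}"
  using assms
proof (transfer, unfold mem_Collect_eq)
  fix r P Q assume r: "0 \<le> r" "r \<le> (1::real)" and "is_fuzzy_number P" "is_fuzzy_number Q"
  note P = level_of_interval[OF this(3)] and Q = level_of_interval[OF this(4)]
  have le: "Inf (level_of P r) \<le> Sup (level_of P r)" "Inf (level_of Q r) \<le> Sup (level_of Q r)"
    if "0 \<le> r" "r \<le> 1" for r using P(2) Q(2) that by (auto simp: endpoints_def)
  show "level_of (of_levels (\<lambda>r. {x + y |x y. x \<in> level_of P r \<and> y \<in> level_of Q r})) r =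
      {x + y |x y. x \<in> level_of P r \<and> y \<in> level_of Q r}"
    by (rule of_levels(2)[OF endpoints_add[OF P(2) Q(2)] _ r])
       (subst P(1), assumption+, subst Q(1), assumption+, rule interval_sum[OF le])
qed

lemma is_fuzzy_number_scale:
  assumes "is_fuzzy_number P"
  shows "is_fuzzy_number (of_levels (\<lambda>r. (*) c ` level_of P r))"
    and "\<And>r. 0 \<le> r \<Longrightarrow> r \<le> 1 \<Longrightarrow>
      level_of (of_levels (\<lambda>r. (*) c ` level_of P r)) r = (*) c ` level_of P r"
proof -
  define l u where "l r = Inf (level_of P r)" and "u r = Sup (level_of P r)" for r
  have P: "\<And>r. 0 \<le> r \<Longrightarrow> r \<le> 1 \<Longrightarrow> level_of P r = {l r..u r}" and E: "endpoints l u"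
    unfolding l_def u_def by (fact level_of_interval[OF assms])+
  have le: "l r \<le> u r" if "0 \<le> r" "r \<le> 1" for r using E that by (auto simp: endpoints_def)
  have "\<exists>l' u'. endpoints l' u' \<and> (\<forall>r. 0 \<le> r \<and> r \<le> 1 \<longrightarrow> (*) c ` level_of P r = {l' r..u' r})"
  proof (cases c "0::real" rule: linorder_cases)
    case greater
    then show ?thesis using endpoints_scale[OF E, of c] le P
      by (intro exI[of _ "\<lambda>r. c * l r"] exI[of _ "\<lambda>r. c * u r"]) (simp add: image_mult_atLeastAtMost_if)
  next
    case less
    then show ?thesis using endpoints_uminus[OF endpoints_scale[OF E, of "-c"]] le P
      by (intro exI[of _ "\<lambda>r. c * u r"] exI[of _ "\<lambda>r. c * l r"]) (simp add: image_mult_atLeastAtMost_if)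
  next
    case equal
    have "endpoints (\<lambda>_. 0) (\<lambda>_. 0)" unfolding endpoints_def
      by (auto intro: dense exI[of _ 1])
    then show ?thesis using le P equal
      by (intro exI[of _ "\<lambda>_. 0"] exI[of _ "\<lambda>_. 0"]) (simp add: image_constant_conv)
  qed
  then obtain l' u' where "endpoints l' u'"
    "\<And>r. 0 \<le> r \<Longrightarrow> r \<le> 1 \<Longrightarrow> (*) c ` level_of P r = {l' r..u' r}" by blast
  from of_levels[OF this] show "is_fuzzy_number (of_levels (\<lambda>r. (*) c ` level_of P r))"
    "\<And>r. 0 \<le> r \<Longrightarrow> r \<le> 1 \<Longrightarrow>
      level_of (of_levels (\<lambda>r. (*) c ` level_of P r)) r = (*) c ` level_of P r" by auto
qed

instantiation fuzzy_number :: scaleR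
begin

lift_definition scaleR_fuzzy_number :: "real \<Rightarrow> fuzzy_number \<Rightarrow> fuzzy_number"
  is "\<lambda>c P. of_levels (\<lambda>r. (*) c ` level_of P r)"
  by (unfold mem_Collect_eq) (rule is_fuzzy_number_scale(1))

instance ..

end

lemma level_scaleR: "0 \<le> r \<Longrightarrow> r \<le> 1 \<Longrightarrow> level (c *\<^sub>R P) r = (*) c ` level P r"
  by transfer (rule is_fuzzy_number_scale(2), simp_all)


section \<open>The Hausdorff metric\<close>

instantiation fuzzy_number :: metric_space
begin

definition dist_fuzzy_number :: "fuzzy_number \<Rightarrow> fuzzy_number \<Rightarrow> real" where
  "dist P Q = (SUP r\<in>{0..1}. max \<bar>lower P r - lower Q r\<bar> \<bar>upper P r - upper Q r\<bar>)"

definition uniformity_fuzzy_number :: "(fuzzy_number \<times> fuzzy_number) filter" where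
  "uniformity_fuzzy_number = (INF e\<in>{0<..}. principal {(P, Q). dist P Q < e})"

definition open_fuzzy_number :: "fuzzy_number set \<Rightarrow> bool" where
  "open_fuzzy_number U \<longleftrightarrow> (\<forall>P\<in>U. \<forall>\<^sub>F (P', Q) in uniformity. P' = P \<longrightarrow> Q \<in> U)"

instance
proof
  let ?d = "\<lambda>P Q r. max \<bar>lower P r - lower Q r\<bar> \<bar>upper P r - upper Q r\<bar>"
  have bdd: "bdd_above (?d P Q ` {0..1})" for P Q
  proof (rule bdd_aboveI2)
    fix r :: real assume "r \<in> {0..1}"
    then have "0 \<le> r" "r \<le> 1" by auto
    then have "lower R 0 \<le> lower R r \<and> lower R r \<le> upper R r \<and> upper R r \<le> upper R 0" for R
      using endpoints_lower_upper[of R] by (auto simp: endpoints_def)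
    from this[of P] this[of Q]
    show "?d P Q r \<le> \<bar>lower P 0\<bar> + \<bar>upper P 0\<bar> + \<bar>lower Q 0\<bar> + \<bar>upper Q 0\<bar>" by linarith
  qed
  have up: "?d P Q r \<le> dist P Q" if "r \<in> {0..1}" for P Q r
    unfolding dist_fuzzy_number_def using that bdd by (rule cSUP_upper)
  show "dist P Q = 0 \<longleftrightarrow> P = Q" for P Q :: fuzzy_number
  proof
    assume z: "dist P Q = 0"
    show "P = Q"
    proof (rule fuzzy_number_eqI)
      fix r :: real assume r: "0 \<le> r" "r \<le> 1"
      then have "lower P r = lower Q r" "upper P r = upper Q r" using up[of r P Q] z by auto
      then show "level P r = level Q r" using level_interval[OF r] by simp
    qed
  qed (simp add: dist_fuzzy_number_def)
  show "dist P Q \<le> dist P R + dist Q R" for P Q R :: fuzzy_number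
    unfolding dist_fuzzy_number_def[of P Q]
  proof (rule cSUP_least)
    fix r :: real assume "r \<in> {0..1}"
    then show "?d P Q r \<le> dist P R + dist Q R" using up[of r P R] up[of r Q R] by linarith
  qed simp
qed (simp_all add: uniformity_fuzzy_number_def open_fuzzy_number_def)

end


section \<open>Triangular fuzzy numbers\<close>

text \<open>The triangular fuzzy number with vertices \<open>p \<le> q \<le> s\<close>; the degenerate cases \<open>p = q\<close> and
  \<open>q = s\<close> are included.\<close>

definition triangular :: "fuzzy_number set" where
  "triangular = {P. \<exists>p q s. p \<le> q \<and> q \<le> s \<and>
     (\<forall>r\<in>{0..1}. level P r = {p + (q - p) * r..s - (s - q) * r})}"


section \<open>Generalized Hukuhara difference and derivatives\<close>

definition is_gH_diff :: "fuzzy_number \<Rightarrow> fuzzy_number \<Rightarrow> fuzzy_number \<Rightarrow> bool" where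
  "is_gH_diff P Q R \<longleftrightarrow> P = Q + R \<or> Q = P + (-1) *\<^sub>R R"

text \<open>There is at most one such \<open>R\<close>; if there is none, the value of \<open>gH_diff\<close> is unspecified.\<close>

lemma is_gH_diff_unique:
  assumes "is_gH_diff P Q R" "is_gH_diff P Q R'"
  shows "R = R'"
proof (rule fuzzy_number_eqI)
  fix r :: real assume r: "0 \<le> r" "r \<le> 1"
  have plus: "lower (A + B) r = lower A r + lower B r \<and> upper (A + B) r = upper A r + upper B r" for A B
  proof -
    have "{lower (A + B) r..upper (A + B) r} = {lower A r + lower B r..upper A r + upper B r}"
      using level_plus[OF r, of A B] level_interval[OF r] lower_le_upper[OF r]
        interval_sum[of "lower A r" "upper A r" "lower B r" "upper B r"] by simp
    then show ?thesis using lower_le_upper[OF r, of "A + B"] by (simp add: Icc_eq_Icc)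
  qed
  have neg: "lower ((-1) *\<^sub>R A) r = - upper A r \<and> upper ((-1) *\<^sub>R A) r = - lower A r" for A
  proof -
    have "{lower ((-1) *\<^sub>R A) r..upper ((-1) *\<^sub>R A) r} = {- upper A r..- lower A r}"
      using level_scaleR[OF r, of "-1" A] level_interval[OF r] lower_le_upper[OF r]
      by (simp add: image_mult_atLeastAtMost_if)
    then show ?thesis using lower_le_upper[OF r, of "(-1) *\<^sub>R A"] by (simp add: Icc_eq_Icc)
  qed
  have "(lower P r = lower Q r + lower S r \<and> upper P r = upper Q r + upper S r) \<or>
      (lower Q r = lower P r - upper S r \<and> upper Q r = upper P r - lower S r)"
    if "is_gH_diff P Q S" for S
    using that plus[of Q S] plus[of P "(-1) *\<^sub>R S"] neg[of S] unfolding is_gH_diff_def by auto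
  from this[OF assms(1)] this[OF assms(2)] have "lower R r = lower R' r \<and> upper R r = upper R' r"
    using lower_le_upper[OF r, of R] lower_le_upper[OF r, of R'] by linarith
  then show "level R r = level R' r" using level_interval[OF r] by simp
qed

definition gH_diff :: "fuzzy_number \<Rightarrow> fuzzy_number \<Rightarrow> fuzzy_number" (infixl "\<ominus>\<^sub>g\<^sub>H" 65) where
  "P \<ominus>\<^sub>g\<^sub>H Q = (THE R. is_gH_diff P Q R)"

text \<open>A fuzzy function on \<open>[a, \<infinity>)\<close> is represented by a total function; at a point \<open>\<tau> > a\<close> the
  limits below depend only on its values near \<open>\<tau>\<close>, hence only on its values on \<open>[a, \<infinity>)\<close>.
  \<open>x /\<^sub>R c\<close> is \<open>inverse c *\<^sub>R x\<close>.\<close>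

definition conf_quotient :: "real \<Rightarrow> real \<Rightarrow> (real \<Rightarrow> fuzzy_number) \<Rightarrow> real \<Rightarrow> real \<Rightarrow> fuzzy_number" where
  "conf_quotient a \<alpha> w \<tau> \<epsilon> = (w (\<tau> + \<epsilon> * (\<tau> - a) powr (1 - \<alpha>)) \<ominus>\<^sub>g\<^sub>H w \<tau>) /\<^sub>R \<epsilon>"

definition gH_conf_differentiable :: "real \<Rightarrow> real \<Rightarrow> (real \<Rightarrow> fuzzy_number) \<Rightarrow> real \<Rightarrow> bool" where
  "gH_conf_differentiable a \<alpha> w \<tau> \<longleftrightarrow> (\<exists>T. (conf_quotient a \<alpha> w \<tau> \<longlongrightarrow> T) (at 0))"

definition gH_conf_deriv :: "real \<Rightarrow> real \<Rightarrow> (real \<Rightarrow> fuzzy_number) \<Rightarrow> real \<Rightarrow> fuzzy_number" where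
  "gH_conf_deriv a \<alpha> w \<tau> = Lim (at 0) (conf_quotient a \<alpha> w \<tau>)"

definition gH_quotient :: "(real \<Rightarrow> fuzzy_number) \<Rightarrow> real \<Rightarrow> real \<Rightarrow> fuzzy_number" where
  "gH_quotient w \<tau> h = (w (\<tau> + h) \<ominus>\<^sub>g\<^sub>H w \<tau>) /\<^sub>R h"

definition gH_differentiable :: "(real \<Rightarrow> fuzzy_number) \<Rightarrow> real \<Rightarrow> bool" where
  "gH_differentiable w \<tau> \<longleftrightarrow> (\<exists>T. (gH_quotient w \<tau> \<longlongrightarrow> T) (at 0))"

definition gH_deriv :: "(real \<Rightarrow> fuzzy_number) \<Rightarrow> real \<Rightarrow> fuzzy_number" where
  "gH_deriv w \<tau> = Lim (at 0) (gH_quotient w \<tau>)"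

end

theory Submission
  imports Defs
begin

text \<open>Put \<open>k = (\<tau> - a) powr (1 - \<alpha>)\<close>, a positive constant because \<open>\<tau> > a\<close>. The increment of
  \<open>w\<close> in the conformable quotient at \<open>\<epsilon>\<close> is the ordinary increment at \<open>h = k \<epsilon>\<close>, so the
  quotients differ only by a scaling of the argument and of the value: the gH-quotient at \<open>h\<close> is
  \<open>1/k\<close> times the conformable quotient at \<open>h/k\<close> (\<open>gH_quotient_eq_conf_quotient\<close>). As \<open>h\<close> tends
  to \<open>0\<close>, so does \<open>h/k\<close>, and multiplication by the scalar \<open>1/k\<close> is continuous because it is
  Lipschitz in the Hausdorff metric (\<open>dist_scaleR_fuzzy_le\<close>). Hence the gH-quotient converges to
  \<open>1/k\<close> times the conformable derivative. Fuzzy numbers do not form a vector space, but scalar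
  multiplication is still associative (\<open>scaleR_scaleR_fuzzy\<close>), which allows \<open>k\<close> to be
  moved to the other side.\<close>

lemma scaleR_scaleR_fuzzy:
  fixes P :: fuzzy_number
  shows "c *\<^sub>R d *\<^sub>R P = (c * d) *\<^sub>R P"
  by (rule fuzzy_number_eqI) (simp add: level_scaleR image_image mult.assoc)

lemma scaleR_one_fuzzy:
  fixes P :: fuzzy_number
  shows "1 *\<^sub>R P = P"
  by (rule fuzzy_number_eqI) (simp add: level_scaleR)

text \<open>A negative scalar reverses the level intervals, so it exchanges the two endpoints.\<close>

lemma
  assumes r: "0 \<le> r" "r \<le> 1"
  shows lower_scaleR: "lower (c *\<^sub>R P) r = (if 0 \<le> c then c * lower P r else c * upper P r)"
    and upper_scaleR: "upper (c *\<^sub>R P) r = (if 0 \<le> c then c * upper P r else c * lower P r)"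
proof -
  have "{lower (c *\<^sub>R P) r..upper (c *\<^sub>R P) r} = (*) c ` {lower P r..upper P r}"
    using level_scaleR[OF r, of c P] level_interval[OF r] by simp
  also have "\<dots> = (if 0 \<le> c then {c * lower P r..c * upper P r} else {c * upper P r..c * lower P r})"
    using lower_le_upper[OF r, of P] by (auto simp: image_mult_atLeastAtMost_if)
  finally have "lower (c *\<^sub>R P) r = (if 0 \<le> c then c * lower P r else c * upper P r) \<and>
      upper (c *\<^sub>R P) r = (if 0 \<le> c then c * upper P r else c * lower P r)"
    using lower_le_upper[OF r, of "c *\<^sub>R P"]
    by (cases "0 \<le> c") (auto simp only: Icc_eq_Icc if_True if_False)
  then show "lower (c *\<^sub>R P) r = (if 0 \<le> c then c * lower P r else c * upper P r)"
    and "upper (c *\<^sub>R P) r = (if 0 \<le> c then c * upper P r else c * lower P r)"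
    by blast+
qed

text \<open>All levels lie in the level at \<open>0\<close>, which is bounded; so the supremum defining the
  Hausdorff distance is over a bounded set and dominates each of its members.\<close>

lemma endpoint_dist_le_dist:
  assumes "r \<in> {0..1}"
  shows "max \<bar>lower P r - lower Q r\<bar> \<bar>upper P r - upper Q r\<bar> \<le> dist P Q"
  unfolding dist_fuzzy_number_def
proof (rule cSUP_upper[OF assms], rule bdd_aboveI2)
  fix s :: real assume "s \<in> {0..1}"
  then have "lower R 0 \<le> lower R s \<and> lower R s \<le> upper R s \<and> upper R s \<le> upper R 0" for R
    using endpoints_lower_upper[of R] by (auto simp: endpoints_def)
  from this[of P] this[of Q]
  show "max \<bar>lower P s - lower Q s\<bar> \<bar>upper P s - upper Q s\<bar>
      \<le> \<bar>lower P 0\<bar> + \<bar>upper P 0\<bar> + \<bar>lower Q 0\<bar> + \<bar>upper Q 0\<bar>" by linarith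
qed

lemma dist_scaleR_fuzzy_le:
  fixes P Q :: fuzzy_number
  shows "dist (c *\<^sub>R P) (c *\<^sub>R Q) \<le> \<bar>c\<bar> * dist P Q"
  unfolding dist_fuzzy_number_def[of "c *\<^sub>R P"]
proof (rule cSUP_least)
  fix r :: real assume r: "r \<in> {0..1}"
  have "\<bar>lower P r - lower Q r\<bar> \<le> dist P Q" and "\<bar>upper P r - upper Q r\<bar> \<le> dist P Q"
    using endpoint_dist_le_dist[OF r, of P Q] by auto
  then show "max \<bar>lower (c *\<^sub>R P) r - lower (c *\<^sub>R Q) r\<bar> \<bar>upper (c *\<^sub>R P) r - upper (c *\<^sub>R Q) r\<bar>
      \<le> \<bar>c\<bar> * dist P Q"
    using r by (simp add: lower_scaleR upper_scaleR abs_mult mult_left_mono flip: right_diff_distrib)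
qed simp

lemma tendsto_scaleR_fuzzy:
  fixes f :: "'a \<Rightarrow> fuzzy_number"
  assumes "(f \<longlongrightarrow> P) F"
  shows "((\<lambda>x. c *\<^sub>R f x) \<longlongrightarrow> c *\<^sub>R P) F"
proof (rule metric_tendsto_imp_tendsto)
  show "((\<lambda>x. \<bar>c\<bar> * dist (f x) P) \<longlongrightarrow> 0) F"
    using assms by (intro tendsto_mult_right_zero) (rule iffD1[OF tendsto_dist_iff])
  show "\<forall>\<^sub>F x in F. dist (c *\<^sub>R f x) (c *\<^sub>R P) \<le> dist (\<bar>c\<bar> * dist (f x) P) 0"
    using dist_scaleR_fuzzy_le[of c _ P] by (simp add: dist_real_def abs_mult)
qed

text \<open>After the substitution \<open>\<epsilon> = h/k\<close> both sides contain the same gH-difference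
  \<open>w (\<tau> + h) \<ominus>\<^sub>g\<^sub>H w \<tau>\<close>; only the scalars in front of it have to be compared.\<close>

lemma gH_quotient_eq_conf_quotient:
  fixes a \<alpha> \<tau> :: real
  defines "k \<equiv> (\<tau> - a) powr (1 - \<alpha>)"
  assumes "\<tau> > a"
  shows "gH_quotient w \<tau> h = inverse k *\<^sub>R conf_quotient a \<alpha> w \<tau> (h / k)"
proof -
  have "k \<noteq> 0" using assms by simp
  then show ?thesis
    by (simp add: gH_quotient_def conf_quotient_def scaleR_scaleR_fuzzy field_simps flip: k_def)
qed

theorem theorem3p2:
  fixes a \<alpha> \<tau> :: real and w :: "real \<Rightarrow> fuzzy_number"
  assumes "a \<ge> 0" and "0 < \<alpha>" and "\<alpha> < 1" and "\<tau> > a"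
    and "\<forall>\<^sub>F h in at 0. \<exists>R\<in>triangular. is_gH_diff (w (\<tau> + h)) (w \<tau>) R"
    and "gH_conf_differentiable a \<alpha> w \<tau>"
  shows "gH_differentiable w \<tau> \<and>
    gH_conf_deriv a \<alpha> w \<tau> = (\<tau> - a) powr (1 - \<alpha>) *\<^sub>R gH_deriv w \<tau>"
proof -
  define k where "k = (\<tau> - a) powr (1 - \<alpha>)"
  have k: "k > 0" using assms(4) by (simp add: k_def)
  obtain T where T: "(conf_quotient a \<alpha> w \<tau> \<longlongrightarrow> T) (at 0)"
    using assms(6) unfolding gH_conf_differentiable_def by blast
  have "filterlim (\<lambda>h. h / k) (at 0) (at 0)"
    unfolding filterlim_at
  proof
    have "((\<lambda>h. h / k) \<longlongrightarrow> 0 / k) (at 0)" using k by (intro tendsto_intros) auto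
    then show "((\<lambda>h. h / k) \<longlongrightarrow> 0) (at 0)" by simp
    show "\<forall>\<^sub>F h in at 0. h / k \<in> UNIV \<and> h / k \<noteq> 0"
      using k by (simp add: eventually_at_filter)
  qed
  then have "((\<lambda>h. inverse k *\<^sub>R conf_quotient a \<alpha> w \<tau> (h / k)) \<longlongrightarrow> inverse k *\<^sub>R T) (at 0)"
    by (intro tendsto_scaleR_fuzzy filterlim_compose[OF T])
  moreover have "gH_quotient w \<tau> = (\<lambda>h. inverse k *\<^sub>R conf_quotient a \<alpha> w \<tau> (h / k))"
    unfolding k_def using assms(4) by (intro ext gH_quotient_eq_conf_quotient)
  ultimately have G: "(gH_quotient w \<tau> \<longlongrightarrow> inverse k *\<^sub>R T) (at 0)"
    by simp
  have "gH_conf_deriv a \<alpha> w \<tau> = T"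
    unfolding gH_conf_deriv_def by (rule tendsto_Lim[OF _ T]) simp
  moreover have "gH_deriv w \<tau> = inverse k *\<^sub>R T"
    unfolding gH_deriv_def by (rule tendsto_Lim[OF _ G]) simp
  moreover have "k *\<^sub>R inverse k *\<^sub>R T = T"
    using k by (simp add: scaleR_scaleR_fuzzy scaleR_one_fuzzy)
  ultimately show ?thesis
    using G unfolding gH_differentiable_def k_def by auto
qed

end
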